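(* Let $G:\mathcal{S}_Y(c_0)\to C(\mathbb{N}^{*})$ be the Gelfand transformation $H\mapsto G_H$, where for $H=\alpha Id+T_\lambda$ (with $\alpha\in\mathbb{K}$, $\lambda=(\lambda_n)_{n\in\mathbb{N}}\in c_0$) one sets $G_H(n)=\alpha+\lambda_n$ for $n\in\mathbb{N}$ and $G_H(0)=\alpha$. Then $G$ is an isometric isomorphism of algebras from $\mathcal{S}_Y(c_0)$ (with the operator norm) onto $C(\mathbb{N}^{*})$ (with the supremum norm).
   Context: $\mathbb{K}$ is a complete non-archimedean valued field whose residue class field is formally real. $c_0$ is the Banach space of sequences $x=(x_n)_{n\in\mathbb{N}}$ in $\mathbb{K}$ with $x_n\to 0$ ($\mathbb{N}=\{1,2,\dots\}$), with norm $\|x\|_\infty=\sup_n|x_n|$ and bilinear form $\langle x,y\rangle=\sum_n x_ny_n$; one has $\|x\|_\infty=\sqrt{|\langle x,x\rangle|}$. $Y=\{y^{(i)}\}_{i\in\mathbb{N}}$ is a fixed orthonormal sequence in $c_0$: $\langle y^{(i)},y^{(j)}\rangle=0$ for $i\ne j$ and $\|y^{(i)}\|_\infty=1$. Put $P_i(x)=\frac{\langle x,y^{(i)}\rangle}{\langle y^{(i)},y^{(i)}\rangle}y^{(i)}$. For $\lambda=(\lambda_i)\in c_0$ let $T_\lambda=\sum_{i=1}^\infty\lambda_iP_i$, a bounded operator on $c_0$. $\mathcal{S}_Y(c_0)=\{\alpha Id+T_\lambda:\alpha\in\mathbb{K},\lambda\in c_0\}$, where $Id$ is the identity operator of $c_0$,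 with the operator norm and composition as multiplication. (The pair $(\alpha,\lambda)$ is uniquely determined by $\alpha Id+T_\lambda$.) $\mathbb{N}^{*}=\mathbb{N}\cup\{0\}$ is the one-point compactification of the discrete space $\mathbb{N}$, with $0$ as the point at infinity, and $C(\mathbb{N}^{*})$ is the algebra of continuous functions $\mathbb{N}^{*}\to\mathbb{K}$ with pointwise operations and the supremum norm. *)

theory Defs
  imports "HOL-Analysis.Analysis" "HOL-Algebra.Algebraic_Closure_Type" "HOL-Algebra.Module"
begin

section \<open>Complete non-archimedean valued fields\<close>

text \<open>
  The absolute value is \<open>vabs\<close>, since the library's \<^const>\<open>norm\<close> is restricted to real
  normed spaces. The metric, the topology and completeness are those of the library, for the
  distance \<open>vabs (x - y)\<close>. The trivial valuation is not excluded.
\<close>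

class complete_nonarch_field = field + complete_space +
  fixes vabs :: "'a \<Rightarrow> real"
  assumes dist_vabs: "dist x y = vabs (x - y)"
    and vabs_mult: "vabs (x * y) = vabs x * vabs y"
    and vabs_add: "vabs (x + y) \<le> max (vabs x) (vabs y)"
begin

lemma vabs_zero_iff: "vabs x = 0 \<longleftrightarrow> x = 0"
  using dist_vabs[of x 0] dist_eq_0_iff[of x 0] by simp

lemma vabs_ge_0: "0 \<le> vabs x"
  using dist_vabs[of x 0] zero_le_dist[of x 0] by simp

end

definition valuation_ring :: "'k::complete_nonarch_field ring" where
  "valuation_ring = ring_of_type_algebra \<lparr>carrier := {x. vabs x \<le> 1}\<rparr>"

definition residue_field :: "'k::complete_nonarch_field set ring" where
  "residue_field = valuation_ring Quot {x. vabs x < 1}"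

definition formally_real :: "('a, 'm) ring_scheme \<Rightarrow> bool" where
  "formally_real R \<longleftrightarrow>
     \<not> (\<exists>(n::nat) a. a \<in> {..<n} \<rightarrow> carrier R \<and>
          \<ominus>\<^bsub>R\<^esub> \<one>\<^bsub>R\<^esub> = (\<Oplus>\<^bsub>R\<^esub>i\<in>{..<n}. a i \<otimes>\<^bsub>R\<^esub> a i))"


section \<open>The Banach space of null sequences\<close>

text \<open>The index set \<open>{1, 2, \<dots>}\<close> of sequences is relabelled as \<^typ>\<open>nat\<close>, starting at \<open>0\<close>.\<close>

typedef (overloaded) 'k c0 = "{x :: nat \<Rightarrow> 'k::complete_nonarch_field. x \<longlonglongrightarrow> 0}"
  morphisms c0_nth Abs_c0
  by (rule exI[of _ "\<lambda>_. 0"]) simp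

setup_lifting type_definition_c0

lemma nonarch_tendsto_0_iff:
  fixes x :: "nat \<Rightarrow> 'k::complete_nonarch_field"
  shows "x \<longlonglongrightarrow> 0 \<longleftrightarrow> (\<lambda>n. vabs (x n)) \<longlonglongrightarrow> 0"
  by (simp add: tendsto_iff dist_vabs vabs_ge_0)

lemma vabs_minus:
  fixes x :: "'k::complete_nonarch_field"
  shows "vabs (- x) = vabs x"
  using dist_commute[of x 0] by (simp add: dist_vabs)

lemma nonarch_null_add:
  fixes x y :: "nat \<Rightarrow> 'k::complete_nonarch_field"
  assumes "x \<longlonglongrightarrow> 0" "y \<longlonglongrightarrow> 0"
  shows "(\<lambda>n. x n + y n) \<longlonglongrightarrow> 0"
proof -
  have *: "(\<lambda>n. max (vabs (x n)) (vabs (y n))) \<longlonglongrightarrow> max 0 0"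
    by (intro tendsto_max) (use assms in \<open>simp_all add: nonarch_tendsto_0_iff\<close>)
  have "(\<lambda>n. vabs (x n + y n)) \<longlonglongrightarrow> 0"
    by (rule tendsto_sandwich[OF _ _ tendsto_const])
      (use * in \<open>auto intro!: always_eventually vabs_ge_0 vabs_add\<close>)
  then show ?thesis by (simp add: nonarch_tendsto_0_iff)
qed

lemma nonarch_null_minus:
  fixes x :: "nat \<Rightarrow> 'k::complete_nonarch_field"
  shows "x \<longlonglongrightarrow> 0 \<Longrightarrow> (\<lambda>n. - x n) \<longlonglongrightarrow> 0"
  by (simp add: nonarch_tendsto_0_iff vabs_minus)

lemma nonarch_null_scale:
  fixes x :: "nat \<Rightarrow> 'k::complete_nonarch_field"
  shows "x \<longlonglongrightarrow> 0 \<Longrightarrow> (\<lambda>n. a * x n) \<longlonglongrightarrow> 0"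
  using tendsto_mult_right_zero[of "\<lambda>n. vabs (x n)" sequentially "vabs a"]
  by (simp add: nonarch_tendsto_0_iff vabs_mult)

instantiation c0 :: (complete_nonarch_field) ab_group_add
begin
lift_definition zero_c0 :: "'a c0" is "\<lambda>_. 0" by simp
lift_definition plus_c0 :: "'a c0 \<Rightarrow> 'a c0 \<Rightarrow> 'a c0" is "\<lambda>x y n. x n + y n"
  by (rule nonarch_null_add)
lift_definition uminus_c0 :: "'a c0 \<Rightarrow> 'a c0" is "\<lambda>x n. - x n"
  by (rule nonarch_null_minus)
definition minus_c0 :: "'a c0 \<Rightarrow> 'a c0 \<Rightarrow> 'a c0" where "minus_c0 x y = x + - y"
instance
  by standard (simp add: minus_c0_def | (transfer, simp add: algebra_simps))+
end

lift_definition c0_scale :: "'k::complete_nonarch_field \<Rightarrow> 'k c0 \<Rightarrow> 'k c0" is "\<lambda>a x n. a * x n"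
  by (rule nonarch_null_scale)

definition c0_norm :: "'k::complete_nonarch_field c0 \<Rightarrow> real" where
  "c0_norm x = (SUP n. vabs (c0_nth x n))"

lemma c0_norm_bdd: "bdd_above (range (\<lambda>n. vabs (c0_nth x n)))"
proof -
  have "(\<lambda>n. vabs (c0_nth x n)) \<longlonglongrightarrow> 0"
    using c0_nth[of x] by (simp add: nonarch_tendsto_0_iff)
  then have "Bseq (\<lambda>n. vabs (c0_nth x n))"
    by (metis convergentI convergent_imp_Bseq)
  then show ?thesis
    by (auto intro: bounded_imp_bdd_above simp: Bseq_eq_bounded)
qed

instantiation c0 :: (complete_nonarch_field) metric_space
begin
definition dist_c0 :: "'a c0 \<Rightarrow> 'a c0 \<Rightarrow> real" where "dist_c0 x y = c0_norm (x - y)"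
definition uniformity_c0 :: "('a c0 \<times> 'a c0) filter" where
  "uniformity_c0 = (INF e\<in>{0 <..}. principal {(x, y). dist x y < e})"
definition open_c0 :: "'a c0 set \<Rightarrow> bool" where
  "open_c0 S = (\<forall>x\<in>S. \<forall>\<^sub>F (x', y) in uniformity. x' = x \<longrightarrow> y \<in> S)"
instance
proof
  fix x y z :: "'a c0"
  have nth_minus: "c0_nth (u - v) n = c0_nth u n - c0_nth v n" for u v :: "'a c0" and n
    unfolding minus_c0_def plus_c0.rep_eq uminus_c0.rep_eq by simp
  have le: "vabs (c0_nth u n) \<le> c0_norm u" for u :: "'a c0" and n
    unfolding c0_norm_def by (rule cSUP_upper[OF UNIV_I c0_norm_bdd])
  show "dist x y = 0 \<longleftrightarrow> x = y"
  proof
    assume "dist x y = 0"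
    then have "vabs (c0_nth x n - c0_nth y n) = 0" for n
      using le[of "x - y" n]
      by (simp add: dist_c0_def nth_minus vabs_ge_0 antisym)
    then show "x = y"
      by (metis c0_nth_inject eq_iff_diff_eq_0 ext vabs_zero_iff)
  next
    assume "x = y"
    moreover have "vabs (0 :: 'a) = 0" by (simp add: vabs_zero_iff)
    ultimately show "dist x y = 0"
      by (simp add: dist_c0_def c0_norm_def zero_c0.rep_eq)
  qed
  show "dist x y \<le> dist x z + dist y z"
    unfolding dist_c0_def c0_norm_def[of "x - y"]
  proof (rule cSUP_least)
    fix n
    have "vabs (c0_nth (x - y) n) \<le> vabs (c0_nth (x - z) n) + vabs (c0_nth (y - z) n)"
      using dist_triangle2[of "c0_nth x n" "c0_nth y n" "c0_nth z n"]
      by (simp add: nth_minus dist_vabs)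
    also have "\<dots> \<le> c0_norm (x - z) + c0_norm (y - z)"
      by (intro add_mono le)
    finally show "vabs (c0_nth (x - y) n) \<le> c0_norm (x - z) + c0_norm (y - z)" .
  qed simp
qed (simp_all add: dist_c0_def uniformity_c0_def open_c0_def)
end

definition c0_form :: "'k::complete_nonarch_field c0 \<Rightarrow> 'k c0 \<Rightarrow> 'k" where
  "c0_form x y = (\<Sum>n. c0_nth x n * c0_nth y n)"

definition orthonormal_seq :: "(nat \<Rightarrow> 'k::complete_nonarch_field c0) \<Rightarrow> bool" where
  "orthonormal_seq Y \<longleftrightarrow>
     (\<forall>i j. i \<noteq> j \<longrightarrow> c0_form (Y i) (Y j) = 0) \<and> (\<forall>i. c0_norm (Y i) = 1)"


section \<open>The operator algebra\<close>

definition c0_proj :: "'k::complete_nonarch_field c0 \<Rightarrow> 'k c0 \<Rightarrow> 'k c0" where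
  "c0_proj y x = c0_scale (c0_form x y / c0_form y y) y"

text \<open>
  The series of operators is summed pointwise, each value \<open>T\<^sub>\<lambda> x\<close> being the limit of the partial
  sums in the norm \<^const>\<open>c0_norm\<close> of \<^typ>\<open>'k c0\<close>.
\<close>

definition T_op ::
    "(nat \<Rightarrow> 'k::complete_nonarch_field c0) \<Rightarrow> 'k c0 \<Rightarrow> 'k c0 \<Rightarrow> 'k c0" where
  "T_op Y l x = (\<Sum>i. c0_scale (c0_nth l i) (c0_proj (Y i) x))"

definition S_op ::
    "(nat \<Rightarrow> 'k::complete_nonarch_field c0) \<Rightarrow> 'k \<Rightarrow> 'k c0 \<Rightarrow> 'k c0 \<Rightarrow> 'k c0" where
  "S_op Y \<alpha> l x = c0_scale \<alpha> x + T_op Y l x"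

text \<open>Same formula as \<^const>\<open>onorm\<close>, which is restricted to real normed spaces.\<close>

definition c0_onorm :: "('k::complete_nonarch_field c0 \<Rightarrow> 'k c0) \<Rightarrow> real" where
  "c0_onorm H = (SUP x. c0_norm (H x) / c0_norm x)"

definition S_algebra ::
    "(nat \<Rightarrow> 'k::complete_nonarch_field c0) \<Rightarrow> ('k, 'k c0 \<Rightarrow> 'k c0) module" where
  "S_algebra Y =
     \<lparr>carrier = {S_op Y \<alpha> l | \<alpha> l. True},
      mult = (\<circ>), one = id,
      zero = (\<lambda>_. 0), add = (\<lambda>H K x. H x + K x),
      smult = (\<lambda>a H x. c0_scale a (H x))\<rparr>"


section \<open>Continuous functions on the one-point compactification\<close>

text \<open>The point at infinity is \<^const>\<open>None\<close>; the isolated points are \<open>Some n\<close>.\<close>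

definition Nstar :: "nat option topology" where
  "Nstar = Alexandroff_compactification (discrete_topology UNIV)"

definition C_algebra :: "('k::complete_nonarch_field, nat option \<Rightarrow> 'k) module" where
  "C_algebra =
     \<lparr>carrier = {f. continuous_map Nstar euclidean f},
      mult = (\<lambda>f g p. f p * g p), one = (\<lambda>_. 1),
      zero = (\<lambda>_. 0), add = (\<lambda>f g p. f p + g p),
      smult = (\<lambda>a f p. a * f p)\<rparr>"

definition sup_norm :: "(nat option \<Rightarrow> 'k::complete_nonarch_field) \<Rightarrow> real" where
  "sup_norm f = (SUP p. vabs (f p))"


section \<open>The Gelfand transformation\<close>

definition gelfand ::
    "(nat \<Rightarrow> 'k::complete_nonarch_field c0) \<Rightarrow> ('k c0 \<Rightarrow> 'k c0) \<Rightarrow> nat option \<Rightarrow> 'k" where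
  "gelfand Y H =
     (let (\<alpha>, l) = (THE (\<alpha>, l). H = S_op Y \<alpha> l)
      in (\<lambda>p. case p of None \<Rightarrow> \<alpha> | Some n \<Rightarrow> \<alpha> + c0_nth l n))"

text \<open>
  The locale \<^locale>\<open>Module.algebra\<close> includes closure of the carriers under the operations, and
  \<^const>\<open>ring_iso\<close> includes bijectivity and preservation of the unit.
\<close>

definition isometric_algebra_iso ::
    "('k, 'r) ring_scheme \<Rightarrow> ('k, 'a, 'm) module_scheme \<Rightarrow> ('a \<Rightarrow> real)
      \<Rightarrow> ('k, 'b, 'n) module_scheme \<Rightarrow> ('b \<Rightarrow> real) \<Rightarrow> ('a \<Rightarrow> 'b) \<Rightarrow> bool" where
  "isometric_algebra_iso K A normA B normB G \<longleftrightarrow>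
     Module.algebra K A \<and> Module.algebra K B \<and> G \<in> ring_iso A B \<and>
     (\<forall>a\<in>carrier K. \<forall>x\<in>carrier A. G (a \<odot>\<^bsub>A\<^esub> x) = a \<odot>\<^bsub>B\<^esub> G x) \<and>
     (\<forall>x\<in>carrier A. normB (G x) = normA x)"

end

theory Submission
  imports Defs
begin

text \<open>
  Since \<open>- 1\<close> is not a sum of squares in the residue field, \<open>\<bar>\<langle>x, x\<rangle>\<bar> = \<parallel>x\<parallel>\<^sup>2\<close>. Hence
  \<open>\<bar>\<langle>y\<^sub>i, y\<^sub>i\<rangle>\<bar> = 1\<close>, the \<open>P\<^sub>i\<close> are mutually orthogonal projections of norm at most \<open>1\<close>, and an
  operator \<open>\<alpha> Id + T\<^sub>\<lambda>\<close> multiplies \<open>y\<^sub>j\<close> by \<open>\<alpha> + \<lambda>\<^sub>j\<close>. These eigenvalues determine \<open>(\<alpha>, \<lambda>)\<close>, because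
  they converge to \<open>\<alpha>\<close>, and they bound the operator norm from below. From above it is bounded by
  \<open>max \<bar>\<alpha>\<bar> \<parallel>\<lambda>\<parallel>\<close>, which by the ultrametric inequality is the supremum of \<open>\<bar>\<alpha>\<bar>\<close> and all
  \<open>\<bar>\<alpha> + \<lambda>\<^sub>j\<bar>\<close>.
\<close>

section \<open>Ultrametric groups\<close>

text \<open>Common ground for the field and for \<open>c0\<close>: both are instances, so the facts
  about convergent series are proved once. Scalars are absent because continuity of addition and
  ultrametric estimates are all that these facts use.\<close>

class ultrametric_group = ab_group_add + metric_space +
  assumes dist_add_right: "dist (x + z) (y + z) = dist x y"
    and dist_ultra: "dist x z \<le> max (dist x y) (dist y z)"
begin

lemma dist_eq_diff: "dist x y = dist (x - y) 0"
  using dist_add_right[of "x - y" y 0] by simp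

lemma dist_minus_0: "dist (- x) 0 = dist x 0"
  using dist_add_right[of "- x" x 0] by (simp add: dist_commute)

lemma dist_add_0_le: "dist (x + y) 0 \<le> max (dist x 0) (dist y 0)"
  using dist_ultra[of "x + y" 0 y] dist_add_right[of x y 0] by simp

end

text \<open>Gives access to the library rules for limits and series of sums and differences, such as
  \<open>sums_add\<close>, in the field and in \<open>c0\<close>.\<close>

instance ultrametric_group \<subseteq> topological_ab_group_add
proof
  fix a b :: 'a
  show "((\<lambda>x. fst x + snd x) \<longlongrightarrow> a + b) (nhds a \<times>\<^sub>F nhds b)"
  proof (rule tendstoI)
    fix e :: real assume "0 < e"
    then have "\<forall>\<^sub>F x in nhds a \<times>\<^sub>F nhds b. dist (fst x) a < e \<and> dist (snd x) b < e"
      by (intro eventually_conj)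
        (use filterlim_fst filterlim_snd in \<open>blast intro: tendstoD\<close>)+
    then show "\<forall>\<^sub>F x in nhds a \<times>\<^sub>F nhds b. dist (fst x + snd x) (a + b) < e"
    proof (rule eventually_mono)
      fix x assume x: "dist (fst x) a < e \<and> dist (snd x) b < e"
      have "dist (fst x + snd x) (a + b) \<le> max (dist (fst x) a) (dist (snd x) b)"
        using dist_add_0_le[of "fst x - a" "snd x - b"]
          dist_eq_diff[of "fst x + snd x" "a + b"] dist_eq_diff[of "fst x" a]
          dist_eq_diff[of "snd x" b]
        by (simp add: algebra_simps)
      with x show "dist (fst x + snd x) (a + b) < e" by linarith
    qed
  qed
  show "(uminus \<longlongrightarrow> - a) (nhds a)"
  proof (rule tendstoI)
    fix e :: real assume "0 < e"
    then have "\<forall>\<^sub>F x in nhds a. dist x a < e"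
      by (auto intro: tendstoD[OF filterlim_ident])
    moreover have "dist (- x) (- a) = dist x a" for x
      using dist_eq_diff[of "- x" "- a"] dist_minus_0[of "x - a"] dist_eq_diff[of x a] by simp
    ultimately show "\<forall>\<^sub>F x in nhds a. dist (- x) (- a) < e" by simp
  qed
qed

section \<open>Estimates and convergence of series in ultrametric groups\<close>

lemma dist_sum_0_le:
  fixes f :: "'i \<Rightarrow> 'a::ultrametric_group"
  assumes "\<And>i. i \<in> A \<Longrightarrow> dist (f i) 0 \<le> B" "0 \<le> B"
  shows "dist (sum f A) 0 \<le> B"
  using assms
  by (induction A rule: infinite_finite_induct)
    (auto intro: order_trans[OF dist_add_0_le])

text \<open>The difference of two partial sums is a block of terms, and the ultrametric inequality
  bounds the block by its largest term. Hence null terms already make the partial sums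
  Cauchy.\<close>

lemma summable_ultrametric:
  fixes f :: "nat \<Rightarrow> 'a::{ultrametric_group, complete_space}"
  assumes "f \<longlonglongrightarrow> 0"
  shows "summable f"
proof -
  have "Cauchy (\<lambda>n. \<Sum>i<n. f i)"
  proof (rule metric_CauchyI)
    fix e :: real assume "0 < e"
    \<comment> \<open>Halving leaves room for strictness: \<open>dist_sum_0_le\<close> yields only a
      non-strict bound.\<close>
    then have "0 < e / 2" by simp
    then obtain N where N: "\<And>n. n \<ge> N \<Longrightarrow> dist (f n) 0 < e / 2"
      using assms unfolding lim_sequentially by blast
    have *: "dist (\<Sum>i<n. f i) (\<Sum>i<m. f i) < e" if "m \<ge> N" "m \<le> n" for m n
    proof -
      have "(\<Sum>i<n. f i) - (\<Sum>i<m. f i) = (\<Sum>i\<in>{m..<n}. f i)"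
        using \<open>m \<le> n\<close> by (simp add: sum_diff_nat_ivl[of 0 m n f, symmetric] atLeast0LessThan)
      moreover have "dist (\<Sum>i\<in>{m..<n}. f i) 0 \<le> e / 2"
        using N that \<open>0 < e\<close> by (intro dist_sum_0_le) (auto intro: less_imp_le)
      ultimately show ?thesis
        using \<open>0 < e\<close> dist_eq_diff[of "\<Sum>i<n. f i" "\<Sum>i<m. f i"] by simp
    qed
    have "dist (\<Sum>i<m. f i) (\<Sum>i<n. f i) < e" if "m \<ge> N" "n \<ge> N" for m n
      using *[of m n] *[of n m] that by (cases "m \<le> n") (auto simp: dist_commute)
    then show "\<exists>M. \<forall>m\<ge>M. \<forall>n\<ge>M. dist (\<Sum>i<m. f i) (\<Sum>i<n. f i) < e" by blast
  qed
  then show ?thesis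
    by (simp add: Cauchy_convergent summable_iff_convergent)
qed

text \<open>The partial sums stay in the closed ball of radius \<open>B\<close>, and closed balls
  are closed under limits.\<close>

lemma sums_dist_0_le:
  fixes f :: "nat \<Rightarrow> 'a::ultrametric_group"
  assumes "f sums s" "\<And>i. dist (f i) 0 \<le> B"
  shows "dist s 0 \<le> B"
proof (rule tendsto_upperbound)
  show "(\<lambda>n. dist (\<Sum>i<n. f i) 0) \<longlonglongrightarrow> dist s 0"
    using assms(1) by (intro tendsto_intros) (simp add: sums_def)
  have "0 \<le> B" using assms(2)[of 0] zero_le_dist[of "f 0" 0] by linarith
  then show "\<forall>\<^sub>F n in sequentially. dist (\<Sum>i<n. f i) 0 \<le> B"
    using assms(2) by (intro always_eventually allI dist_sum_0_le)
qed simp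

text \<open>A bounded additive map is Lipschitz, hence continuous, and may be moved inside a series.
  It is applied to scalar multiplication and to the bilinear form in its first argument.\<close>

lemma bounded_additive_sums:
  fixes f :: "nat \<Rightarrow> 'a::ultrametric_group" and h :: "'a \<Rightarrow> 'b::ultrametric_group"
  assumes f: "f sums s" and add: "\<And>x y. h (x + y) = h x + h y"
    and bound: "\<And>x. dist (h x) 0 \<le> C * dist x 0"
  shows "(\<lambda>i. h (f i)) sums h s"
proof -
  interpret additive h by standard (rule add)
  have "(\<lambda>n. h (\<Sum>i<n. f i)) \<longlonglongrightarrow> h s"
  proof (rule tendsto_dist_iff[THEN iffD2], rule Lim_null_comparison)
    show "(\<lambda>n. C * dist (\<Sum>i<n. f i) s) \<longlonglongrightarrow> 0"
      using f unfolding sums_def by (intro tendsto_mult_right_zero) (simp flip: tendsto_dist_iff)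
    have "dist (h (\<Sum>i<n. f i)) (h s) \<le> C * dist (\<Sum>i<n. f i) s" for n
      using bound[of "(\<Sum>i<n. f i) - s"] dist_eq_diff[of "h (\<Sum>i<n. f i)" "h s"]
        dist_eq_diff[of "\<Sum>i<n. f i" s]
      by (simp add: diff)
    then show "\<forall>\<^sub>F n in sequentially.
        norm (dist (h (\<Sum>i<n. f i)) (h s)) \<le> C * dist (\<Sum>i<n. f i) s"
      by simp
  qed
  then show ?thesis by (simp add: sums_def sum)
qed

section \<open>Sums of squares and the formally real residue field\<close>

lemma vabs_eq_dist: "vabs x = dist x 0" for x :: "'k::complete_nonarch_field"
  by (simp add: dist_vabs)

instance complete_nonarch_field \<subseteq> ultrametric_group
proof
  fix x y z :: 'a
  show "dist (x + z) (y + z) = dist x y" by (simp add: dist_vabs)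
  show "dist x z \<le> max (dist x y) (dist y z)"
    using vabs_add[of "x - y" "y - z"] by (simp add: dist_vabs)
qed

lemma vabs_1 [simp]: "vabs (1 :: 'k::complete_nonarch_field) = 1"
  using vabs_mult[of "1 :: 'k" 1] vabs_zero_iff[of "1 :: 'k"] by simp

lemma vabs_0 [simp]: "vabs (0 :: 'k::complete_nonarch_field) = 0"
  by (simp add: vabs_zero_iff)

lemma vabs_divide: "vabs (x / y) = vabs x / vabs y" for x :: "'k::complete_nonarch_field"
proof (cases "y = 0")
  case False
  then show ?thesis using vabs_mult[of "x / y" y] by (simp add: vabs_zero_iff)
qed simp

text \<open>Translates between the sum of the ring record and the sum of the field type, so that a
  sum of squares can be pushed through the quotient map. The bound on \<open>f\<close> keeps the
  summands in the carrier.\<close>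

lemma finsum_valuation_ring:
  fixes f :: "nat \<Rightarrow> 'k::complete_nonarch_field"
  assumes "cring (valuation_ring :: 'k ring)" "\<And>i. i < n \<Longrightarrow> vabs (f i) \<le> 1"
  shows "(\<Oplus>\<^bsub>valuation_ring\<^esub>i\<in>{..<n}. f i) = (\<Sum>i<n. f i)"
proof -
  interpret cring "valuation_ring :: 'k ring" by (fact assms)
  show ?thesis using assms(2)
  proof (induction n)
    case 0
    have "\<zero>\<^bsub>valuation_ring\<^esub> = (0 :: 'k)"
      by (simp add: valuation_ring_def ring_of_type_algebra_def)
    then show ?case by simp
  next
    case (Suc n)
    then have "f \<in> {..<n} \<rightarrow> carrier valuation_ring" "f n \<in> carrier valuation_ring"
      by (auto simp: valuation_ring_def)
    then have "(\<Oplus>\<^bsub>valuation_ring\<^esub>i\<in>{..<Suc n}. f i) = f n \<oplus>\<^bsub>valuation_ring\<^esub> (\<Oplus>\<^bsub>valuation_ring\<^esub>i\<in>{..<n}. f i)"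
      by (simp add: lessThan_Suc)
    also have "\<dots> = f n + (\<Sum>i<n. f i)"
      using Suc by (simp add: valuation_ring_def ring_of_type_algebra_def)
    finally show ?case by simp
  qed
qed

lemma cring_valuation_ring: "cring (valuation_ring :: 'k::complete_nonarch_field ring)"
proof (rule cringI)
  show "abelian_group (valuation_ring :: 'k ring)"
  proof (rule abelian_groupI)
    fix x :: 'k
    assume "x \<in> carrier valuation_ring"
    then show "\<exists>y\<in>carrier valuation_ring. y \<oplus>\<^bsub>valuation_ring\<^esub> x = \<zero>\<^bsub>valuation_ring\<^esub>"
      by (intro bexI[of _ "- x"])
        (auto simp: valuation_ring_def ring_of_type_algebra_def vabs_minus)
  qed (auto simp: valuation_ring_def ring_of_type_algebra_def algebra_simps
        intro: order_trans[OF vabs_add])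
  show "Group.comm_monoid (valuation_ring :: 'k ring)"
    by (rule comm_monoidI)
      (auto simp: valuation_ring_def ring_of_type_algebra_def vabs_mult vabs_ge_0 mult_le_one algebra_simps)
qed (auto simp: valuation_ring_def ring_of_type_algebra_def algebra_simps)

lemma ideal_valuation_ring: "ideal {x. vabs x < 1} (valuation_ring :: 'k::complete_nonarch_field ring)"
proof -
  interpret cring "valuation_ring :: 'k ring" by (rule cring_valuation_ring)
  \<comment> \<open>The record's additive inverse is sought inside the carrier; uniqueness of
    inverses identifies it with negation in the field.\<close>
  have minus: "\<ominus>\<^bsub>valuation_ring\<^esub> x = - x" if "vabs x \<le> 1" for x :: 'k
    using that minus_equality[of "- x" x]
    by (simp add: valuation_ring_def ring_of_type_algebra_def vabs_minus)
  show ?thesis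
  proof (rule idealI)
    show "Ring.ring (valuation_ring :: 'k ring)" by (rule ring_axioms)
    show "subgroup {x. vabs x < 1} (add_monoid (valuation_ring :: 'k ring))"
    proof (rule add.subgroupI)
      show "\<ominus>\<^bsub>valuation_ring\<^esub> a \<in> {x. vabs x < 1}" if "a \<in> {x. vabs x < 1}" for a :: 'k
        using that by (metis minus less_imp_le mem_Collect_eq vabs_minus)
      show "{x :: 'k. vabs x < 1} \<noteq> {}" by (auto intro: exI[of _ 0])
    qed (auto simp: valuation_ring_def ring_of_type_algebra_def intro: le_less_trans[OF vabs_add])
  next
    fix a x :: 'k
    assume a: "a \<in> {x. vabs x < 1}" and x: "x \<in> carrier valuation_ring"
    have "vabs x * vabs a < 1"
      using a x mult_left_le_one_le[of "vabs a" "vabs x"]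
      by (auto simp: vabs_ge_0 valuation_ring_def intro: le_less_trans)
    then show "x \<otimes>\<^bsub>valuation_ring\<^esub> a \<in> {x. vabs x < 1}" "a \<otimes>\<^bsub>valuation_ring\<^esub> x \<in> {x. vabs x < 1}"
      by (simp_all add: valuation_ring_def ring_of_type_algebra_def vabs_mult mult.commute)
  qed
qed

text \<open>Otherwise the element would lie in the maximal ideal, and its image in the residue field
  would exhibit -1 as a sum of squares.\<close>

lemma vabs_one_plus_squares:
  fixes b :: "nat \<Rightarrow> 'k::complete_nonarch_field"
  assumes real: "formally_real (residue_field :: 'k set ring)"
    and b: "\<And>i. i < n \<Longrightarrow> vabs (b i) \<le> 1"
  shows "vabs (1 + (\<Sum>i<n. b i * b i)) = 1"
proof (rule ccontr)
  let ?V = "valuation_ring :: 'k ring" and ?I = "{x :: 'k. vabs x < 1}"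
  let ?s = "\<Sum>i<n. b i * b i"
  interpret V: cring ?V by (rule cring_valuation_ring)
  interpret I: ideal ?I ?V by (rule ideal_valuation_ring)
  let ?q = "(+>\<^bsub>?V\<^esub>) ?I"
  interpret q: ring_hom_cring ?V "?V Quot ?I" ?q
    by (rule I.rcos_ring_hom_cring[OF cring_valuation_ring])
  have bb: "vabs (b i * b i) \<le> 1" if "i < n" for i
    using b[OF that] by (simp add: vabs_mult vabs_ge_0 mult_le_one)
  have s: "vabs ?s \<le> 1"
    using dist_sum_0_le[of "{..<n}" "\<lambda>i. b i * b i" 1] bb by (simp add: vabs_eq_dist)
  assume "vabs (1 + ?s) \<noteq> 1"
  moreover have "vabs (1 + ?s) \<le> 1"
    using vabs_add[of 1 ?s] s by simp
  ultimately have "1 + ?s \<in> ?I" by simp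
  then have "?q (\<one>\<^bsub>?V\<^esub> \<oplus>\<^bsub>?V\<^esub> ?s) = \<zero>\<^bsub>?V Quot ?I\<^esub>"
    using I.a_rcos_const[of "1 + ?s"]
    by (simp add: FactRing_def valuation_ring_def ring_of_type_algebra_def)
  moreover have sV: "?s \<in> carrier ?V" using s by (simp add: valuation_ring_def)
  ultimately have "\<one>\<^bsub>?V Quot ?I\<^esub> \<oplus>\<^bsub>?V Quot ?I\<^esub> ?q ?s = \<zero>\<^bsub>?V Quot ?I\<^esub>"
    using q.hom_add[of "\<one>\<^bsub>?V\<^esub>" ?s] q.hom_one by simp
  then have neg: "\<ominus>\<^bsub>?V Quot ?I\<^esub> \<one>\<^bsub>?V Quot ?I\<^esub> = ?q ?s"
    using sV by (simp add: q.S.minus_equality q.S.a_comm)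
  have bV: "b i \<in> carrier ?V" if "i < n" for i
    using b[OF that] by (simp add: valuation_ring_def)
  have "?q ?s = ?q (\<Oplus>\<^bsub>?V\<^esub>i\<in>{..<n}. b i \<otimes>\<^bsub>?V\<^esub> b i)"
    using finsum_valuation_ring[OF cring_valuation_ring, of n "\<lambda>i. b i * b i"] bb
    by (simp add: valuation_ring_def ring_of_type_algebra_def)
  also have "\<dots> = (\<Oplus>\<^bsub>?V Quot ?I\<^esub>i\<in>{..<n}. (?q \<circ> (\<lambda>i. b i \<otimes>\<^bsub>?V\<^esub> b i)) i)"
    using bV by (intro q.hom_finsum) auto
  also have "\<dots> = (\<Oplus>\<^bsub>?V Quot ?I\<^esub>i\<in>{..<n}. ?q (b i) \<otimes>\<^bsub>?V Quot ?I\<^esub> ?q (b i))"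
    using bV by (intro q.S.finsum_cong') auto
  finally have "\<ominus>\<^bsub>?V Quot ?I\<^esub> \<one>\<^bsub>?V Quot ?I\<^esub> =
      (\<Oplus>\<^bsub>?V Quot ?I\<^esub>i\<in>{..<n}. ?q (b i) \<otimes>\<^bsub>?V Quot ?I\<^esub> ?q (b i))"
    using neg by simp
  moreover have "(\<lambda>i. ?q (b i)) \<in> {..<n} \<rightarrow> carrier (?V Quot ?I)"
    using bV by auto
  ultimately show False
    using real unfolding formally_real_def residue_field_def by blast
qed

text \<open>Factoring out the square of a largest term \<open>x m\<close> leaves 1 plus squares of
  quotients of absolute value at most 1, so \<open>vabs_one_plus_squares\<close> applies.\<close>

lemma vabs_sum_squares:
  fixes x :: "nat \<Rightarrow> 'k::complete_nonarch_field"
  assumes real: "formally_real (residue_field :: 'k set ring)"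
    and "m < n" and max: "\<And>i. i < n \<Longrightarrow> vabs (x i) \<le> vabs (x m)"
  shows "vabs (\<Sum>i<n. x i * x i) = vabs (x m) ^ 2"
proof (cases "x m = 0")
  case True
  then have "x i = 0" if "i < n" for i
    using max[OF that] vabs_ge_0[of "x i"] vabs_zero_iff[of "x i"] by simp
  then show ?thesis by (simp add: True)
next
  case False
  \<comment> \<open>The term at \<open>m\<close> contributes the summand 1; setting
    \<open>b m\<close> to 0 lets the remaining sum run over all indices below
    \<open>n\<close>.\<close>
  define b where "b i = (if i = m then 0 else x i / x m)" for i
  have "(\<Sum>i<n. x i * x i) = x m * x m + (\<Sum>i\<in>{..<n} - {m}. x i * x i)"
    using \<open>m < n\<close> by (simp add: sum.remove)
  also have "(\<Sum>i\<in>{..<n} - {m}. x i * x i) = x m * x m * (\<Sum>i\<in>{..<n} - {m}. b i * b i)"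
    unfolding sum_distrib_left by (rule sum.cong) (auto simp: b_def False)
  also have "(\<Sum>i\<in>{..<n} - {m}. b i * b i) = (\<Sum>i<n. b i * b i)"
    by (rule sum.mono_neutral_left) (auto simp: b_def)
  finally have "(\<Sum>i<n. x i * x i) = x m * x m * (1 + (\<Sum>i<n. b i * b i))"
    by (simp add: algebra_simps)
  moreover have "vabs (1 + (\<Sum>i<n. b i * b i)) = 1"
    using max vabs_ge_0[of "x m"]
    by (intro vabs_one_plus_squares[OF real])
      (auto simp: b_def vabs_divide divide_le_eq_1 less_le vabs_zero_iff False)
  ultimately show ?thesis by (simp add: vabs_mult power2_eq_square)
qed

section \<open>The space of null sequences\<close>

lemma c0_eqI: "(\<And>n. c0_nth x n = c0_nth y n) \<Longrightarrow> x = y"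
  by (simp add: c0_nth_inject[symmetric] fun_eq_iff)

lemma c0_nth_diff [simp]: "c0_nth (x - y) n = c0_nth x n - c0_nth y n"
  unfolding minus_c0_def plus_c0.rep_eq uminus_c0.rep_eq by simp

lemmas c0_nth_simps [simp] = plus_c0.rep_eq uminus_c0.rep_eq zero_c0.rep_eq c0_scale.rep_eq

lemma vabs_c0_nth_le: "vabs (c0_nth x n) \<le> c0_norm x"
  unfolding c0_norm_def by (rule cSUP_upper[OF UNIV_I c0_norm_bdd])

lemma c0_norm_le: "(\<And>n. vabs (c0_nth x n) \<le> B) \<Longrightarrow> c0_norm x \<le> B"
  unfolding c0_norm_def by (rule cSUP_least) auto

lemma c0_norm_eq_dist: "c0_norm x = dist x 0"
  by (simp add: dist_c0_def)

lemma c0_norm_ge_0: "0 \<le> c0_norm x"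
  by (simp add: c0_norm_eq_dist)

instance c0 :: (complete_nonarch_field) ultrametric_group
proof
  fix x y z :: "'a c0"
  show "dist (x + z) (y + z) = dist x y" by (simp add: dist_c0_def)
  have "vabs (c0_nth x n - c0_nth z n) \<le> max (c0_norm (x - y)) (c0_norm (y - z))" for n
    using vabs_add[of "c0_nth (x - y) n" "c0_nth (y - z) n"]
      vabs_c0_nth_le[of "x - y" n] vabs_c0_nth_le[of "y - z" n] by simp
  then show "dist x z \<le> max (dist x y) (dist y z)"
    unfolding dist_c0_def by (intro c0_norm_le) simp
qed

lemma dist_c0_nth_le: "dist (c0_nth x n) (c0_nth y n) \<le> dist x y"
  using vabs_c0_nth_le[of "x - y" n] by (simp add: dist_vabs dist_c0_def)

text \<open>The limit is formed coordinatewise. Convergence is uniform in the coordinate, which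
  shows both that the limit is a null sequence and that it is approached in norm.\<close>

instance c0 :: (complete_nonarch_field) complete_space
proof
  fix u :: "nat \<Rightarrow> 'a c0"
  assume u: "Cauchy u"
  have "Cauchy (\<lambda>k. c0_nth (u k) n)" for n
    by (rule metric_CauchyI)
      (use metric_CauchyD[OF u] in \<open>blast intro: le_less_trans[OF dist_c0_nth_le]\<close>)
  then have "convergent (\<lambda>k. c0_nth (u k) n)" for n
    by (rule Cauchy_convergent)
  moreover define z where "z n = lim (\<lambda>k. c0_nth (u k) n)" for n
  ultimately have z: "(\<lambda>k. c0_nth (u k) n) \<longlonglongrightarrow> z n" for n
    by (simp add: convergent_LIMSEQ_iff)
  have unif: "\<exists>N. \<forall>k\<ge>N. \<forall>n. dist (c0_nth (u k) n) (z n) \<le> e" if "0 < e" for e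
  proof -
    obtain N where N: "\<And>k m. k \<ge> N \<Longrightarrow> m \<ge> N \<Longrightarrow> dist (u k) (u m) < e"
      using metric_CauchyD[OF u \<open>0 < e\<close>] by blast
    have "dist (c0_nth (u k) n) (z n) \<le> e" if "k \<ge> N" for k n
    proof (rule tendsto_upperbound)
      show "(\<lambda>m. dist (c0_nth (u k) n) (c0_nth (u m) n)) \<longlonglongrightarrow> dist (c0_nth (u k) n) (z n)"
        by (intro tendsto_intros z)
      show "\<forall>\<^sub>F m in sequentially. dist (c0_nth (u k) n) (c0_nth (u m) n) \<le> e"
        using N[OF that]
        by (intro eventually_sequentiallyI[of N]) (blast intro: order_trans[OF dist_c0_nth_le] less_imp_le)
    qed simp
    then show ?thesis by blast
  qed
  have "z \<longlonglongrightarrow> 0"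
  proof (rule metric_LIMSEQ_I)
    fix e :: real assume "0 < e"
    \<comment> \<open>A single \<open>u k\<close> that is uniformly close to \<open>z\<close>
      suffices: \<open>z\<close> inherits its decay by the ultrametric inequality.\<close>
    with unif[of "e / 2"] obtain k where k: "\<And>n. dist (c0_nth (u k) n) (z n) \<le> e / 2" by auto
    obtain N where N: "\<And>n. n \<ge> N \<Longrightarrow> dist (c0_nth (u k) n) 0 < e"
      using c0_nth[of "u k"] \<open>0 < e\<close> unfolding lim_sequentially by auto
    have "dist (z n) 0 < e" if "n \<ge> N" for n
      using dist_ultra[of "z n" 0 "c0_nth (u k) n"] k[of n] N[OF that] \<open>0 < e\<close>
      by (simp add: dist_commute)
    then show "\<exists>N. \<forall>n\<ge>N. dist (z n) 0 < e" by blast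
  qed
  then have nth: "c0_nth (Abs_c0 z) = z" by (simp add: Abs_c0_inverse)
  have "u \<longlonglongrightarrow> Abs_c0 z"
  proof (rule metric_LIMSEQ_I)
    fix e :: real assume "0 < e"
    with unif[of "e / 2"] obtain N
      where N: "\<And>k n. k \<ge> N \<Longrightarrow> dist (c0_nth (u k) n) (z n) \<le> e / 2" by auto
    have "dist (u k) (Abs_c0 z) < e" if "k \<ge> N" for k
    proof -
      have "dist (u k) (Abs_c0 z) \<le> e / 2"
        unfolding dist_c0_def by (rule c0_norm_le) (use N[OF that] in \<open>simp add: nth dist_vabs\<close>)
      also have "\<dots> < e" using \<open>0 < e\<close> by simp
      finally show ?thesis .
    qed
    then show "\<exists>N. \<forall>k\<ge>N. dist (u k) (Abs_c0 z) < e" by blast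
  qed
  then show "convergent u" by (rule convergentI)
qed

section \<open>Scalar multiplication on null sequences\<close>

lemma c0_norm_scale [simp]: "c0_norm (c0_scale a x) = vabs a * c0_norm x"
proof (rule antisym)
  show "c0_norm (c0_scale a x) \<le> vabs a * c0_norm x"
    by (rule c0_norm_le) (simp add: vabs_mult mult_left_mono vabs_c0_nth_le vabs_ge_0)
  show "vabs a * c0_norm x \<le> c0_norm (c0_scale a x)"
  proof (cases "a = 0")
    case True
    then show ?thesis by (simp add: c0_norm_ge_0)
  next
    case False
    then have "0 < vabs a" using vabs_ge_0[of a] vabs_zero_iff[of a] by linarith
    have "c0_norm x \<le> c0_norm (c0_scale a x) / vabs a"
    proof (rule c0_norm_le)
      show "vabs (c0_nth x n) \<le> c0_norm (c0_scale a x) / vabs a" for n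
        using vabs_c0_nth_le[of "c0_scale a x" n] \<open>0 < vabs a\<close>
        by (simp add: vabs_mult pos_le_divide_eq mult.commute)
    qed
    then show ?thesis using \<open>0 < vabs a\<close> by (simp add: pos_le_divide_eq mult.commute)
  qed
qed

lemma c0_scale_add_right: "c0_scale a (x + y) = c0_scale a x + c0_scale a y"
  by (rule c0_eqI) (simp add: algebra_simps)

lemma c0_scale_add_left: "c0_scale (a + b) x = c0_scale a x + c0_scale b x"
  by (rule c0_eqI) (simp add: algebra_simps)

lemma c0_scale_scale [simp]: "c0_scale a (c0_scale b x) = c0_scale (a * b) x"
  by (rule c0_eqI) (simp add: algebra_simps)

lemma c0_scale_1 [simp]: "c0_scale 1 x = x"
  by (rule c0_eqI) simp

lemma c0_scale_0 [simp]: "c0_scale 0 x = 0"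
  by (rule c0_eqI) simp

lemma c0_scale_zero_right [simp]: "c0_scale a 0 = 0"
  by (rule c0_eqI) simp

text \<open>All but finitely many coordinates of a null sequence are smaller than a given nonzero
  one, so a maximum exists. Its index is the one that \<open>vabs_sum_squares\<close> asks
  for.\<close>

lemma c0_norm_attained:
  obtains m where "\<And>n. vabs (c0_nth x n) \<le> vabs (c0_nth x m)"
proof (cases "\<forall>n. vabs (c0_nth x n) = 0")
  case True
  then show ?thesis by (intro that[of 0]) simp
next
  case False
  then obtain k where k: "vabs (c0_nth x k) > 0"
    using vabs_ge_0 by (metis less_le)
  then obtain N where N: "\<And>n. n \<ge> N \<Longrightarrow> vabs (c0_nth x n) < vabs (c0_nth x k)"
    using c0_nth[of x] unfolding lim_sequentially mem_Collect_eq vabs_eq_dist by blast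
  let ?S = "(\<lambda>n. vabs (c0_nth x n)) ` {..<N}"
  \<comment> \<open>Otherwise the coordinate \<open>k\<close> would be smaller than itself. So
    \<open>k\<close> lies in the initial segment, whose maximum then dominates the tail as
    well.\<close>
  have kN: "k < N" using N[of k] by (meson less_irrefl not_le)
  then have "Max ?S \<in> ?S" by (intro Max_in) auto
  then obtain m where m: "m < N" "Max ?S = vabs (c0_nth x m)" by auto
  have le: "vabs (c0_nth x n) \<le> vabs (c0_nth x m)" if "n < N" for n
    unfolding m(2)[symmetric] using that by (intro Max_ge) auto
  then have "vabs (c0_nth x n) \<le> vabs (c0_nth x m)" for n
    using N[of n] le[OF kN] le[of n] by (cases "n < N") auto
  then show ?thesis by (rule that)
qed

section \<open>The bilinear form and the projections\<close>

lemma vabs_mult_c0_le: "vabs (c0_nth x n * c0_nth y n) \<le> c0_norm x * c0_norm y"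
  unfolding vabs_mult by (intro mult_mono vabs_c0_nth_le c0_norm_ge_0 vabs_ge_0)

text \<open>The coordinatewise product serves twice: its terms are those of the series for the form,
  and it is the coefficient sequence of a composition of two diagonal operators.\<close>

lift_definition c0_mult :: "'k::complete_nonarch_field c0 \<Rightarrow> 'k c0 \<Rightarrow> 'k c0" is "\<lambda>x y n. x n * y n"
  using tendsto_mult_zero by (simp add: nonarch_tendsto_0_iff vabs_mult)

lemma c0_form_sums: "(\<lambda>n. c0_nth x n * c0_nth y n) sums c0_form x y"
  unfolding c0_form_def using c0_nth[of "c0_mult x y"]
  by (intro summable_sums summable_ultrametric) (simp add: c0_mult.rep_eq)

lemma vabs_c0_form_le: "vabs (c0_form x y) \<le> c0_norm x * c0_norm y"
  unfolding vabs_eq_dist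
  by (rule sums_dist_0_le[OF c0_form_sums]) (simp add: vabs_mult_c0_le flip: vabs_eq_dist)

lemma c0_form_add_left: "c0_form (x + y) z = c0_form x z + c0_form y z"
  using sums_unique2[OF c0_form_sums[of "x + y" z]]
    sums_add[OF c0_form_sums[of x z] c0_form_sums[of y z]]
  by (simp add: distrib_right)

lemma c0_form_scale_left: "c0_form (c0_scale a x) y = a * c0_form x y"
proof -
  have "(\<lambda>n. a * (c0_nth x n * c0_nth y n)) sums (a * c0_form x y)"
    by (rule bounded_additive_sums[OF c0_form_sums, of _ "vabs a"])
      (simp_all add: distrib_left vabs_mult flip: vabs_eq_dist)
  then show ?thesis
    using sums_unique2[OF c0_form_sums[of "c0_scale a x" y]] by (simp add: algebra_simps)
qed

text \<open>Once the partial sums include a largest coordinate, \<open>vabs_sum_squares\<close>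
  fixes their absolute value at the square of that coordinate's absolute value, so the limit has
  this value too.\<close>

lemma vabs_c0_form_self:
  fixes x :: "'k::complete_nonarch_field c0"
  assumes "formally_real (residue_field :: 'k set ring)"
  shows "vabs (c0_form x x) = (c0_norm x)\<^sup>2"
proof -
  obtain m where m: "\<And>n. vabs (c0_nth x n) \<le> vabs (c0_nth x m)"
    using c0_norm_attained[of x] by blast
  then have norm: "c0_norm x = vabs (c0_nth x m)"
    by (intro antisym c0_norm_le vabs_c0_nth_le)
  have "(\<lambda>n. dist (\<Sum>i<n. c0_nth x i * c0_nth x i) 0) \<longlonglongrightarrow> dist (c0_form x x) 0"
    using c0_form_sums[of x x] unfolding sums_def by (intro tendsto_intros)
  moreover have "(\<lambda>n. dist (\<Sum>i<n. c0_nth x i * c0_nth x i) 0) \<longlonglongrightarrow> (c0_norm x)\<^sup>2"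
    \<comment> \<open>The sum over \<open>i < n\<close> contains the index \<open>m\<close> from
      \<open>n = Suc m\<close> onwards.\<close>
    using vabs_sum_squares[OF assms, of m _ "c0_nth x"] m
    by (intro tendsto_eventually eventually_sequentiallyI[of "Suc m"])
      (simp add: norm flip: vabs_eq_dist)
  ultimately show ?thesis unfolding vabs_eq_dist by (rule LIMSEQ_unique)
qed

lemma c0_proj_add: "c0_proj y (x + x') = c0_proj y x + c0_proj y x'"
  by (simp add: c0_proj_def c0_form_add_left add_divide_distrib c0_scale_add_left)

lemma c0_proj_scale: "c0_proj y (c0_scale a x) = c0_scale a (c0_proj y x)"
  by (simp add: c0_proj_def c0_form_scale_left)

section \<open>Diagonal operators\<close>

locale real_orthonormal_seq =
  fixes Y :: "nat \<Rightarrow> 'k::complete_nonarch_field c0"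
  assumes residue_real: "formally_real (residue_field :: 'k set ring)"
    and orthonormal: "orthonormal_seq Y"
begin

lemma norm_Y [simp]: "c0_norm (Y i) = 1"
  using orthonormal by (simp add: orthonormal_seq_def)

lemma form_Y: "i \<noteq> j \<Longrightarrow> c0_form (Y i) (Y j) = 0"
  using orthonormal by (simp add: orthonormal_seq_def)

lemma vabs_form_Y_self [simp]: "vabs (c0_form (Y i) (Y i)) = 1"
  by (simp add: vabs_c0_form_self[OF residue_real])

lemma form_Y_self_nonzero [simp]: "c0_form (Y i) (Y i) \<noteq> 0"
  using vabs_form_Y_self[of i] by (metis vabs_0 zero_neq_one)

lemma proj_Y: "c0_proj (Y i) (Y j) = (if i = j then Y j else 0)"
  by (auto simp: c0_proj_def form_Y)

text \<open>The denominator of the projection has absolute value 1 and \<open>Y i\<close> has norm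
  1, so only the bound on the form remains.\<close>

lemma norm_proj_le: "c0_norm (c0_proj (Y i) x) \<le> c0_norm x"
  using vabs_c0_form_le[of x "Y i"] by (simp add: c0_proj_def vabs_divide)

text \<open>The projections of \<open>x\<close> are bounded by the norm of \<open>x\<close> and the
  coefficients tend to 0, so the terms are null and completeness gives convergence. Later identities
  for \<open>T_op\<close> compare such series termwise.\<close>

lemma T_op_sums: "(\<lambda>i. c0_scale (c0_nth l i) (c0_proj (Y i) x)) sums T_op Y l x"
  unfolding T_op_def
proof (rule summable_sums, rule summable_ultrametric, rule tendsto_dist_iff[THEN iffD2], rule Lim_null_comparison)
  show "(\<lambda>i. vabs (c0_nth l i) * c0_norm x) \<longlonglongrightarrow> 0"
    using c0_nth[of l] by (intro tendsto_mult_left_zero) (simp add: nonarch_tendsto_0_iff)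
  show "\<forall>\<^sub>F i in sequentially. norm (dist (c0_scale (c0_nth l i) (c0_proj (Y i) x)) 0)
      \<le> vabs (c0_nth l i) * c0_norm x"
    by (simp add: mult_left_mono norm_proj_le vabs_ge_0 c0_norm_ge_0 abs_mult flip: c0_norm_eq_dist)
qed

lemma norm_T_op_le: "c0_norm (T_op Y l x) \<le> c0_norm l * c0_norm x"
  unfolding c0_norm_eq_dist[of "T_op Y l x"]
  by (rule sums_dist_0_le[OF T_op_sums])
    (simp add: mult_mono norm_proj_le vabs_ge_0 vabs_c0_nth_le c0_norm_ge_0 flip: c0_norm_eq_dist)

lemma T_op_add: "T_op Y l (x + y) = T_op Y l x + T_op Y l y"
  using sums_unique2[OF T_op_sums[of l "x + y"]]
    sums_add[OF T_op_sums[of l x] T_op_sums[of l y]]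
  by (simp add: c0_proj_add c0_scale_add_right)

lemma T_op_add_left: "T_op Y (l + m) x = T_op Y l x + T_op Y m x"
  using sums_unique2[OF T_op_sums[of "l + m" x]]
    sums_add[OF T_op_sums[of l x] T_op_sums[of m x]]
  by (simp add: c0_scale_add_left)

text \<open>Scaling the vector and scaling the coefficients both lead to this series, which settles
  \<open>T_op_scale\<close> and \<open>T_op_scale_left\<close> together.\<close>

lemma scale_T_op_sums: "(\<lambda>i. c0_scale (a * c0_nth l i) (c0_proj (Y i) x)) sums c0_scale a (T_op Y l x)"
proof -
  have "(\<lambda>i. c0_scale a (c0_scale (c0_nth l i) (c0_proj (Y i) x))) sums c0_scale a (T_op Y l x)"
    by (rule bounded_additive_sums[OF T_op_sums c0_scale_add_right, of _ "vabs a"])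
      (simp flip: c0_norm_eq_dist)
  then show ?thesis by simp
qed

lemma T_op_scale: "T_op Y l (c0_scale a x) = c0_scale a (T_op Y l x)"
  using sums_unique2[OF T_op_sums[of l "c0_scale a x"]] scale_T_op_sums[of a l x]
  by (simp add: c0_proj_scale mult.commute)

lemma T_op_scale_left: "T_op Y (c0_scale a l) x = c0_scale a (T_op Y l x)"
  using sums_unique2[OF T_op_sums[of "c0_scale a l" x]] scale_T_op_sums[of a l x] by simp

text \<open>Continuity of the form moves it inside the series, where orthogonality leaves only the
  term at \<open>j\<close>.\<close>

lemma form_T_op: "c0_form (T_op Y l x) (Y j) = c0_nth l j * c0_form x (Y j)"
proof -
  have "(\<lambda>i. c0_form (c0_scale (c0_nth l i) (c0_proj (Y i) x)) (Y j)) sums c0_form (T_op Y l x) (Y j)"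
    by (rule bounded_additive_sums[OF T_op_sums c0_form_add_left, of _ 1])
      (use vabs_c0_form_le[of _ "Y j"] in \<open>simp flip: vabs_eq_dist c0_norm_eq_dist\<close>)
  moreover have "c0_form (c0_scale (c0_nth l i) (c0_proj (Y i) x)) (Y j) =
      (if i = j then c0_nth l i * c0_form x (Y i) else 0)" for i
    by (auto simp: c0_form_scale_left c0_proj_def form_Y)
  ultimately show ?thesis
    using sums_unique2[OF sums_single[of j "\<lambda>i. c0_nth l i * c0_form x (Y i)"]] by simp
qed

lemma proj_T_op: "c0_proj (Y i) (T_op Y l x) = c0_scale (c0_nth l i) (c0_proj (Y i) x)"
  by (simp add: c0_proj_def form_T_op)

text \<open>By \<open>proj_T_op\<close> each projection turns the inner operator into a scalar, so
  both sides are sums of the same series.\<close>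

lemma T_op_T_op: "T_op Y l (T_op Y m x) = T_op Y (c0_mult l m) x"
  using sums_unique2[OF T_op_sums[of l "T_op Y m x"]] T_op_sums[of "c0_mult l m" x]
  by (simp add: proj_T_op c0_mult.rep_eq)

lemma T_op_Y: "T_op Y l (Y j) = c0_scale (c0_nth l j) (Y j)"
proof -
  have "c0_scale (c0_nth l i) (c0_proj (Y i) (Y j)) = (if i = j then c0_scale (c0_nth l i) (Y i) else 0)" for i
    by (simp add: proj_Y)
  then show ?thesis
    using sums_unique2[OF T_op_sums[of l "Y j"]] sums_single[of j "\<lambda>i. c0_scale (c0_nth l i) (Y i)"]
    by simp
qed

section \<open>Sums, multiples and products of operators in terms of their coefficients\<close>

lemma S_op_plus_S_op: "S_op Y \<alpha> l x + S_op Y \<beta> m x = S_op Y (\<alpha> + \<beta>) (l + m) x"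
  by (simp add: S_op_def T_op_add_left c0_scale_add_left)

lemma scale_S_op: "c0_scale a (S_op Y \<alpha> l x) = S_op Y (a * \<alpha>) (c0_scale a l) x"
  by (simp add: S_op_def T_op_scale_left c0_scale_add_right)

text \<open>This is the product in the algebra obtained from \<open>c0\<close>, with coordinatewise
  multiplication, by adjoining a unit.\<close>

lemma S_op_S_op:
  "S_op Y \<alpha> l (S_op Y \<beta> m x) =
   S_op Y (\<alpha> * \<beta>) (c0_scale \<alpha> m + c0_scale \<beta> l + c0_mult l m) x"
  by (simp add: S_op_def T_op_add T_op_add_left T_op_scale T_op_scale_left T_op_T_op
      c0_scale_add_right)

lemma T_op_zero_left: "T_op Y 0 x = 0"
  using T_op_scale_left[of 0 0 x] by simp

lemma S_op_zero: "S_op Y 0 0 x = 0"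
  by (simp add: S_op_def T_op_zero_left)

lemma S_op_one: "S_op Y 1 0 x = x"
  by (simp add: S_op_def T_op_zero_left)

lemma S_op_Y: "S_op Y \<alpha> l (Y j) = c0_scale (\<alpha> + c0_nth l j) (Y j)"
  by (simp add: S_op_def T_op_Y c0_scale_add_left)

end

section \<open>Functions on the compactification\<close>

text \<open>Parametrises functions by the same pairs as \<open>S_op\<close>, so that the Gelfand
  transformation becomes the identity on pairs.\<close>

definition c_fun :: "'k::complete_nonarch_field \<Rightarrow> 'k c0 \<Rightarrow> nat option \<Rightarrow> 'k" where
  "c_fun \<alpha> l p = (case p of None \<Rightarrow> \<alpha> | Some n \<Rightarrow> \<alpha> + c0_nth l n)"

lemma c_fun_simps [simp]:
  "c_fun \<alpha> l None = \<alpha>" "c_fun \<alpha> l (Some n) = \<alpha> + c0_nth l n"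
  by (simp_all add: c_fun_def)

lemma c_fun_inject: "c_fun \<alpha> l = c_fun \<beta> m \<longleftrightarrow> \<alpha> = \<beta> \<and> l = m"
proof
  assume eq: "c_fun \<alpha> l = c_fun \<beta> m"
  have "\<alpha> = \<beta>" using fun_cong[OF eq, of None] by simp
  moreover have "c0_nth l n = c0_nth m n" for n
    using fun_cong[OF eq, of "Some n"] \<open>\<alpha> = \<beta>\<close> by simp
  ultimately show "\<alpha> = \<beta> \<and> l = m" by (blast intro: c0_eqI)
qed simp

lemma c_fun_add: "(\<lambda>p. c_fun \<alpha> l p + c_fun \<beta> m p) = c_fun (\<alpha> + \<beta>) (l + m)"
  by (rule ext) (simp add: c_fun_def algebra_simps split: option.split)

text \<open>The resulting pair agrees with that of \<open>S_op_S_op\<close>, which makes the Gelfand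
  transformation multiplicative.\<close>

lemma c_fun_mult: "(\<lambda>p. c_fun \<alpha> l p * c_fun \<beta> m p) =
    c_fun (\<alpha> * \<beta>) (c0_scale \<alpha> m + c0_scale \<beta> l + c0_mult l m)"
  by (rule ext) (simp add: c_fun_def c0_mult.rep_eq algebra_simps split: option.split)

lemma c_fun_scale: "(\<lambda>p. a * c_fun \<alpha> l p) = c_fun (a * \<alpha>) (c0_scale a l)"
  by (rule ext) (simp add: c_fun_def algebra_simps split: option.split)

lemma c_fun_one: "c_fun 1 0 = (\<lambda>_. 1)"
  by (rule ext) (simp add: c_fun_def split: option.split)

section \<open>Continuity on the compactification and the algebra of continuous functions\<close>

lemma topspace_Nstar [simp]: "topspace Nstar = UNIV"
  by (simp add: Nstar_def UNIV_option_conv)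

text \<open>Compact sets of a discrete space are finite, so neighbourhoods of infinity are the
  cofinite sets containing it, and the sequential filter on the naturals is the cofinite one. Sets
  of isolated points are open.\<close>

lemma continuous_map_Nstar_iff:
  "continuous_map Nstar euclidean f \<longleftrightarrow> (\<lambda>n. f (Some n)) \<longlonglongrightarrow> f None"
proof
  assume f: "continuous_map Nstar euclidean f"
  show "(\<lambda>n. f (Some n)) \<longlonglongrightarrow> f None"
  proof (rule topological_tendstoI)
    fix S assume "open S" "f None \<in> S"
    with f have "openin Nstar {p. f p \<in> S}"
      by (simp add: continuous_map_def)
    then obtain C where C: "finite C" "{p. f p \<in> S} = insert None (Some ` (- C))"
      using \<open>f None \<in> S\<close> unfolding Nstar_def openin_Alexandroff_compactification
      by (auto simp: compactin_discrete_topology Compl_eq_Diff_UNIV)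
    have "f (Some n) \<in> S" if "n \<notin> C" for n
    proof -
      have "Some n \<in> {p. f p \<in> S}" unfolding C(2) using that by simp
      then show ?thesis by simp
    qed
    then have "finite {n. f (Some n) \<notin> S}"
      using C(1) by (elim rev_finite_subset) auto
    then show "\<forall>\<^sub>F n in sequentially. f (Some n) \<in> S"
      unfolding cofinite_eq_sequentially[symmetric] eventually_cofinite .
  qed
next
  assume lim: "(\<lambda>n. f (Some n)) \<longlonglongrightarrow> f None"
  have "openin Nstar {p. f p \<in> S}" if "open S" for S
  proof (cases "f None \<in> S")
    case True
    then have "finite {n. f (Some n) \<notin> S}"
      using topological_tendstoD[OF lim \<open>open S\<close>]
      unfolding cofinite_eq_sequentially[symmetric] eventually_cofinite by blast
    moreover have "{p. f p \<in> S} = insert None (Some ` (UNIV - {n. f (Some n) \<notin> S}))"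
    proof (rule Set.set_eqI)
      show "p \<in> {p. f p \<in> S} \<longleftrightarrow> p \<in> insert None (Some ` (UNIV - {n. f (Some n) \<notin> S}))" for p
        using True by (cases p) auto
    qed
    ultimately show ?thesis
      unfolding Nstar_def openin_Alexandroff_compactification
      by (intro disjI2 exI[of _ "{n. f (Some n) \<notin> S}"]) (simp add: compactin_discrete_topology)
  next
    case False
    have "{p. f p \<in> S} = Some ` {n. f (Some n) \<in> S}"
    proof (rule Set.set_eqI)
      show "p \<in> {p. f p \<in> S} \<longleftrightarrow> p \<in> Some ` {n. f (Some n) \<in> S}" for p
        using False by (cases p) auto
    qed
    then show ?thesis
      unfolding Nstar_def by simp
  qed
  then show "continuous_map Nstar euclidean f"
    by (simp add: continuous_map_def)
qed

text \<open>Subtracting from a continuous function its value at infinity leaves a null sequence on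
  the isolated points.\<close>

lemma carrier_C_algebra: "carrier C_algebra = {c_fun \<alpha> l | \<alpha> l. True}"
proof safe
  fix f :: "nat option \<Rightarrow> 'a"
  assume "f \<in> carrier C_algebra"
  then have "(\<lambda>n. f (Some n)) \<longlonglongrightarrow> f None"
    by (simp add: C_algebra_def continuous_map_Nstar_iff)
  then have "(\<lambda>n. f (Some n) - f None) \<longlonglongrightarrow> f None - f None"
    by (intro tendsto_intros)
  then have "f = c_fun (f None) (Abs_c0 (\<lambda>n. f (Some n) - f None))"
    by (intro ext) (simp add: c_fun_def Abs_c0_inverse split: option.split)
  then show "\<exists>\<alpha> l. f = c_fun \<alpha> l \<and> True" by blast
next
  fix \<alpha> :: 'a and l
  have "(\<lambda>n. \<alpha> + c0_nth l n) \<longlonglongrightarrow> \<alpha> + 0"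
    using c0_nth[of l] by (intro tendsto_intros) simp
  then show "c_fun \<alpha> l \<in> carrier C_algebra"
    by (simp add: C_algebra_def continuous_map_Nstar_iff)
qed

lemma algebra_C_algebra: "Module.algebra ring_of_type_algebra (C_algebra :: ('k::complete_nonarch_field, _) module)"
proof -
  let ?C = "C_algebra :: ('k, nat option \<Rightarrow> 'k) module"
  have add: "f \<oplus>\<^bsub>?C\<^esub> g \<in> carrier ?C" and mult: "f \<otimes>\<^bsub>?C\<^esub> g \<in> carrier ?C"
    if "f \<in> carrier ?C" "g \<in> carrier ?C" for f g
    using that by (auto simp: carrier_C_algebra) (auto simp: C_algebra_def c_fun_add c_fun_mult)
  have smult: "a \<odot>\<^bsub>?C\<^esub> f \<in> carrier ?C" if "f \<in> carrier ?C" for a f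
    using that by (auto simp: carrier_C_algebra) (auto simp: C_algebra_def c_fun_scale)
  have zero: "\<zero>\<^bsub>?C\<^esub> \<in> carrier ?C" and one: "\<one>\<^bsub>?C\<^esub> \<in> carrier ?C"
    by (simp_all add: C_algebra_def)
  have neg: "\<exists>g\<in>carrier ?C. g \<oplus>\<^bsub>?C\<^esub> f = \<zero>\<^bsub>?C\<^esub>" if "f \<in> carrier ?C" for f
    by (rule bexI[OF _ smult[OF that, of "- 1"]]) (simp add: C_algebra_def)
  show ?thesis
  proof (rule algebraI)
    show "cring (ring_of_type_algebra :: 'k ring)" ..
    show "cring ?C"
    proof (rule cringI)
      show "abelian_group ?C"
        by (rule abelian_groupI) (use add zero neg in \<open>auto simp: C_algebra_def algebra_simps\<close>)
      show "Group.comm_monoid ?C"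
        by (rule comm_monoidI) (use mult one in \<open>auto simp: C_algebra_def algebra_simps\<close>)
    qed (simp add: C_algebra_def algebra_simps)
  qed (use smult in \<open>simp_all add: C_algebra_def ring_of_type_algebra_def algebra_simps\<close>)
qed

lemma vabs_c_fun_le: "vabs (c_fun \<alpha> l p) \<le> max (vabs \<alpha>) (c0_norm l)"
proof (cases p)
  case (Some n)
  then show ?thesis using vabs_add[of \<alpha> "c0_nth l n"] vabs_c0_nth_le[of l n] by simp
qed simp

lemma vabs_c_fun_le_sup_norm: "vabs (c_fun \<alpha> l p) \<le> sup_norm (c_fun \<alpha> l)"
  unfolding sup_norm_def
  by (intro cSUP_upper bdd_aboveI2[of _ _ "max (vabs \<alpha>) (c0_norm l)"] vabs_c_fun_le) simp

text \<open>For the lower bound, \<open>c0_nth l n\<close> is the difference of the values at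
  \<open>Some n\<close> and at infinity, so the ultrametric inequality bounds it by the
  supremum.\<close>

lemma sup_norm_c_fun: "sup_norm (c_fun \<alpha> l) = max (vabs \<alpha>) (c0_norm l)"
proof (rule antisym)
  show "sup_norm (c_fun \<alpha> l) \<le> max (vabs \<alpha>) (c0_norm l)"
    unfolding sup_norm_def by (intro cSUP_least vabs_c_fun_le) simp
  have \<alpha>: "vabs \<alpha> \<le> sup_norm (c_fun \<alpha> l)"
    using vabs_c_fun_le_sup_norm[of \<alpha> l None] by simp
  moreover have "vabs (c0_nth l n) \<le> sup_norm (c_fun \<alpha> l)" for n
    using vabs_add[of "\<alpha> + c0_nth l n" "- \<alpha>"] vabs_c_fun_le_sup_norm[of \<alpha> l "Some n"] \<alpha>
    by (simp add: vabs_minus)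
  ultimately show "max (vabs \<alpha>) (c0_norm l) \<le> sup_norm (c_fun \<alpha> l)"
    by (simp add: c0_norm_le)
qed

section \<open>The isomorphism\<close>

context real_orthonormal_seq
begin

text \<open>Makes the description in \<open>gelfand\<close> well defined, and reduces the algebra
  laws to identities between pairs.\<close>

lemma S_op_inject: "S_op Y \<alpha> l = S_op Y \<beta> m \<longleftrightarrow> \<alpha> = \<beta> \<and> l = m"
proof
  assume eq: "S_op Y \<alpha> l = S_op Y \<beta> m"
  have *: "\<alpha> + c0_nth l j = \<beta> + c0_nth m j" for j
  proof -
    have "c0_scale (\<alpha> + c0_nth l j) (Y j) = c0_scale (\<beta> + c0_nth m j) (Y j)"
      using fun_cong[OF eq, of "Y j"] by (simp add: S_op_Y)
    \<comment> \<open>Pairing with \<open>Y j\<close> gives scalar multiples of a nonzero element,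
      which can be cancelled.\<close>
    then have "c0_form (c0_scale (\<alpha> + c0_nth l j) (Y j)) (Y j) =
        c0_form (c0_scale (\<beta> + c0_nth m j) (Y j)) (Y j)" by simp
    then show ?thesis by (simp add: c0_form_scale_left)
  qed
  have lim: "(\<lambda>j. \<gamma> + c0_nth k j) \<longlonglongrightarrow> \<gamma>" for \<gamma> and k :: "'k c0"
    using tendsto_add[OF tendsto_const c0_nth[of k, unfolded mem_Collect_eq]] by simp
  have "\<alpha> = \<beta>" using lim[of \<alpha> l] lim[of \<beta> m] by (simp add: * LIMSEQ_unique)
  then show "\<alpha> = \<beta> \<and> l = m" using * by (auto intro: c0_eqI)
qed simp

lemma gelfand_S_op: "gelfand Y (S_op Y \<alpha> l) = c_fun \<alpha> l"
proof -
  have "(THE (\<beta>, m). S_op Y \<alpha> l = S_op Y \<beta> m) = (\<alpha>, l)"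
    by (rule the_equality) (auto simp: S_op_inject)
  then show ?thesis by (auto simp: gelfand_def c_fun_def)
qed

lemma norm_S_op_le: "c0_norm (S_op Y \<alpha> l x) \<le> max (vabs \<alpha>) (c0_norm l) * c0_norm x"
proof -
  have "c0_norm (S_op Y \<alpha> l x) \<le> max (vabs \<alpha> * c0_norm x) (c0_norm l * c0_norm x)"
    using dist_add_0_le[of "c0_scale \<alpha> x" "T_op Y l x"] norm_T_op_le[of l x]
    by (auto simp: S_op_def simp flip: c0_norm_eq_dist)
  then show ?thesis by (simp add: max_mult_distrib_right c0_norm_ge_0)
qed

lemma c0_onorm_S_op: "c0_onorm (S_op Y \<alpha> l) = sup_norm (c_fun \<alpha> l)"
proof (rule antisym)
  have bound: "c0_norm (S_op Y \<alpha> l x) / c0_norm x \<le> max (vabs \<alpha>) (c0_norm l)" for x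
  proof (cases "c0_norm x = 0")
    \<comment> \<open>The supremum also ranges over the zero vector, where division by zero makes
      the quotient 0.\<close>
    case True
    then show ?thesis using vabs_ge_0[of \<alpha>] by simp
  next
    case False
    then have "0 < c0_norm x" using c0_norm_ge_0[of x] by simp
    then show ?thesis using norm_S_op_le by (simp add: pos_divide_le_eq)
  qed
  show "c0_onorm (S_op Y \<alpha> l) \<le> sup_norm (c_fun \<alpha> l)"
    unfolding c0_onorm_def sup_norm_c_fun by (intro cSUP_least bound) simp
  have upper: "c0_norm (S_op Y \<alpha> l x) / c0_norm x \<le> c0_onorm (S_op Y \<alpha> l)" for x
    unfolding c0_onorm_def by (intro cSUP_upper bdd_aboveI2[OF bound]) simp
  have Some: "vabs (\<alpha> + c0_nth l j) \<le> c0_onorm (S_op Y \<alpha> l)" for j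
    using upper[of "Y j"] by (simp add: S_op_Y)
  \<comment> \<open>The eigenvalues at the \<open>Y j\<close> bound the isolated values only; the
    value at infinity is reached as their limit.\<close>
  have "(\<lambda>j. dist (\<alpha> + c0_nth l j) 0) \<longlonglongrightarrow> dist (\<alpha> + 0) 0"
    using c0_nth[of l] by (intro tendsto_intros) simp
  then have "vabs \<alpha> \<le> c0_onorm (S_op Y \<alpha> l)"
    using Some by (intro tendsto_upperbound[of _ _ sequentially]) (auto simp: vabs_eq_dist)
  then have "vabs (c_fun \<alpha> l p) \<le> c0_onorm (S_op Y \<alpha> l)" for p
    using Some by (cases p) auto
  then show "sup_norm (c_fun \<alpha> l) \<le> c0_onorm (S_op Y \<alpha> l)"
    unfolding sup_norm_def by (intro cSUP_least) auto
qed

section \<open>The algebra of operators and the bijection\<close>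

lemma S_algebra_simps:
  "carrier (S_algebra Y) = {S_op Y \<alpha> l | \<alpha> l. True}"
  "S_op Y \<alpha> l \<oplus>\<^bsub>S_algebra Y\<^esub> S_op Y \<beta> m = S_op Y (\<alpha> + \<beta>) (l + m)"
  "S_op Y \<alpha> l \<otimes>\<^bsub>S_algebra Y\<^esub> S_op Y \<beta> m =
    S_op Y (\<alpha> * \<beta>) (c0_scale \<alpha> m + c0_scale \<beta> l + c0_mult l m)"
  "a \<odot>\<^bsub>S_algebra Y\<^esub> S_op Y \<alpha> l = S_op Y (a * \<alpha>) (c0_scale a l)"
  "\<zero>\<^bsub>S_algebra Y\<^esub> = S_op Y 0 0"
  "\<one>\<^bsub>S_algebra Y\<^esub> = S_op Y 1 0"
  by (auto simp: S_algebra_def S_op_plus_S_op S_op_S_op scale_S_op S_op_zero S_op_one)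

text \<open>Injectivity of \<open>S_op\<close> turns each law into an identity in the field and a
  coordinatewise identity in \<open>c0\<close>; commutativity of composition comes from the symmetry
  of the product formula.\<close>

lemma algebra_S_algebra: "Module.algebra ring_of_type_algebra (S_algebra Y)"
proof -
  have nth: "c0_nth (c0_mult x y) n = c0_nth x n * c0_nth y n" for x y :: "'k c0" and n
    by (simp add: c0_mult.rep_eq)
  have neg: "S_op Y (- \<alpha>) (- l) \<oplus>\<^bsub>S_algebra Y\<^esub> S_op Y \<alpha> l = \<zero>\<^bsub>S_algebra Y\<^esub>" for \<alpha> l
    by (simp add: S_algebra_simps)
  show ?thesis
  proof (rule algebraI)
    show "cring (ring_of_type_algebra :: 'k ring)" ..
    show "cring (S_algebra Y)"
    proof (rule cringI)
      show "abelian_group (S_algebra Y)"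
      proof (rule abelian_groupI)
        fix x assume "x \<in> carrier (S_algebra Y)"
        then show "\<exists>y\<in>carrier (S_algebra Y). y \<oplus>\<^bsub>S_algebra Y\<^esub> x = \<zero>\<^bsub>S_algebra Y\<^esub>"
          using neg unfolding S_algebra_simps(1) by blast
      qed (auto simp: S_algebra_simps S_op_inject algebra_simps)
      show "Group.comm_monoid (S_algebra Y)"
        by (rule comm_monoidI)
          (auto simp: S_algebra_simps S_op_inject nth algebra_simps intro!: c0_eqI)
    qed (auto simp: S_algebra_simps S_op_inject nth algebra_simps intro!: c0_eqI)
  qed (auto simp: S_algebra_simps S_op_inject nth ring_of_type_algebra_def algebra_simps
      intro!: c0_eqI)
qed

text \<open>Both carriers are parametrised by the same pairs, faithfully by
  \<open>S_op_inject\<close> and \<open>c_fun_inject\<close>, and the operations agree on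
  pairs.\<close>

lemma gelfand_ring_iso: "gelfand Y \<in> ring_iso (S_algebra Y) C_algebra"
proof (rule ring_iso_memI)
  show "bij_betw (gelfand Y) (carrier (S_algebra Y)) (carrier C_algebra)"
    unfolding bij_betw_def
  proof
    show "inj_on (gelfand Y) (carrier (S_algebra Y))"
      by (auto simp: inj_on_def S_algebra_simps gelfand_S_op c_fun_inject)
    show "gelfand Y ` carrier (S_algebra Y) = carrier C_algebra"
      by (force simp: S_algebra_simps carrier_C_algebra gelfand_S_op image_iff)
  qed
qed (auto simp: S_algebra_simps carrier_C_algebra gelfand_S_op,
    auto simp: C_algebra_def c_fun_add c_fun_mult c_fun_one)

end

theorem theorem2p9:
  fixes Y :: "nat \<Rightarrow> 'k::complete_nonarch_field c0"
  assumes "formally_real (residue_field :: 'k set ring)"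
    and "orthonormal_seq Y"
  shows "isometric_algebra_iso (ring_of_type_algebra :: 'k ring)
           (S_algebra Y) c0_onorm C_algebra sup_norm (gelfand Y)"
proof -
  interpret real_orthonormal_seq Y by standard (fact assms)+
  show ?thesis
    unfolding isometric_algebra_iso_def
  proof (intro conjI ballI)
    fix x assume "x \<in> carrier (S_algebra Y)"
    then obtain \<alpha> l where x: "x = S_op Y \<alpha> l" by (auto simp: S_algebra_simps)
    show "sup_norm (gelfand Y x) = c0_onorm x"
      by (simp add: x gelfand_S_op c0_onorm_S_op)
    show "gelfand Y (a \<odot>\<^bsub>S_algebra Y\<^esub> x) = a \<odot>\<^bsub>C_algebra\<^esub> gelfand Y x" for a
      by (simp add: x S_algebra_simps gelfand_S_op C_algebra_def c_fun_scale)
  qed (fact algebra_S_algebra algebra_C_algebra gelfand_ring_iso)+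
qed

end
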